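(* Consider levels $\ell=1,\dots,\ell_F$ with mesh sizes $h_\ell>0$ satisfying $h_{\ell+1}\le h_\ell$, node sets $\Gamma^\ell$ and discrete operators as in the context, and a set $\Theta$ of parameters (those encountered in a multilevel run). Assume there are a normed function space $X(\Gamma)$, exponents $s>0$ and $\nu>0$, and constants $C_X,C_S,C_Q,C_1$, all independent of the level, such that: (i) $\|r_\theta\|_{X(\Gamma)}\le C_X$ for every $\theta\in\Theta$; (ii) for every level $\ell$ and all $v\in X(\Gamma)$, $$\|v\|_{L^2(\Gamma)}^2\le C_S\Bigl(\|\Pi_{\Gamma^\ell}v\|_{W^\ell}^2+h_\ell^{2s}\|v\|_{X(\Gamma)}^2\Bigr),$$ $$\|\Pi_{\Gamma^\ell}v\|_{W^\ell}^2\le C_Q\Bigl(\|v\|_{L^2(\Gamma)}^2+h_\ell^{2s}\|v\|_{X(\Gamma)}^2\Bigr);$$ (iii) for every level $\ell$ and every $\theta\in\Theta$, $\|\Pi_{\Gamma^\ell}[r_\theta]-r_\theta^{(\ell)}\|_{W^\ell}\le C_1h_\ell^{\nu}$. Let $m:=\min(s,\nu)$. Then there is a constant $C$, independent of the level, such that for every $\ell<\ell_F$, every $\varepsilon_\ell\ge0$, and every $\theta\in\Theta$ with $L^{(\ell)}(\theta)\le\varepsilon_\ell$, $$L^{(\ell+1)}(\theta)\le C\bigl(\varepsilon_\ell+h_\ell^{2m}\bigr).$$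
   Context: $\Gamma=\partial\Omega$ is the $C^2$ boundary of a bounded domain $\Omega\subset\mathbb{R}^d$, $d\ge2$, with surface measure $dS$. $\mathcal{A}\rho=\tfrac12\rho+\mathcal{K}\rho$ with $(\mathcal{K}\rho)(x)=\int_\Gamma k(x,y)\rho(y)\,dS(y)$ is a second-kind boundary integral operator and $g:\Gamma\to\mathbb{R}$ is given data. For a parameter $\theta\in\mathbb{R}^p$, $\rho_\theta:\Gamma\to\mathbb{R}$ is a (continuous) parametrized density and $r_\theta:=\mathcal{A}\rho_\theta-g$ is the continuum residual. At level $\ell$: $\Gamma^\ell=\{x_1^\ell,\dots,x_{N_\ell}^\ell\}\subset\Gamma$ is a set of quadrature nodes with positive weights $w_j^\ell$ and mesh size $h_\ell$ (node sets are not assumed nested); $W^\ell=\mathrm{diag}(w_1^\ell,\dots,w_{N_\ell}^\ell)$; $\|u\|_{W^\ell}^2=\sum_j w_j^\ell u_j^2$ for $u\in\mathbb{R}^{N_\ell}$; $\Pi_{\Gamma^\ell}[v]=(v(x_j^\ell))_{j=1}^{N_\ell}$ is nodal restriction; $A_{N_\ell}=\tfrac12 I+K_{N_\ell}\in\mathbb{R}^{N_\ell\times N_\ell}$, where $K_{N_\ell}$ is the Nyström matrix $(K_{N_\ell}\phi)_i=\sum_j w_j^\ell k(x_i^\ell,x_j^\ell)\phi_j$ (with any near-diagonal regularization of a singular kernel suppressed in the notation); $g_{N_\ell}=\Pi_{\Gamma^\ell}[g]$. The level-$\ell$ discrete residual and loss are $$r_\theta^{(\ell)}:=A_{N_\ell}\Pi_{\Gamma^\ell}[\rho_\theta]-g_{N_\ell},\qquad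 L^{(\ell)}(\theta):=\tfrac12\|r_\theta^{(\ell)}\|_{W^\ell}^2.$$ The space $X(\Gamma)$ consists of continuous functions on $\Gamma$ (so that nodal restriction is defined), and $r_\theta\in X(\Gamma)$ for $\theta\in\Theta$. "Independent of the level" means that $C$ does not depend on $\ell$, $\theta$ or $\varepsilon_\ell$; it may depend on $C_X,C_S,C_Q,C_1,s,\nu$ and on the coarsest mesh size $h_1$. *)

theory Defs
  imports "HOL-Analysis.Analysis" "Jordan_Normal_Form.Matrix"
begin

section \<open>Surface measure\<close>

text \<open>
  The surface measure on the boundary of a domain is the Hausdorff measure of codimension one.
  The weight of a set of diameter \<open>t\<close> is the Lebesgue measure of a ball of diameter \<open>t\<close> in
  \<open>n\<close>-space, so that the \<open>n\<close>-dimensional Hausdorff measure on \<open>n\<close>-space is Lebesgue measure.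
  The empty set is treated separately because \<open>0 ^ 0 = 1\<close>.
\<close>

definition hausdorff_weight :: "nat \<Rightarrow> 'a::metric_space set \<Rightarrow> ennreal" where
  "hausdorff_weight n U =
     (if U = {} then 0 else ennreal (unit_ball_vol (real n) * (diameter U / 2) ^ n))"

definition hausdorff_content :: "nat \<Rightarrow> real \<Rightarrow> 'a::metric_space set \<Rightarrow> ennreal" where
  "hausdorff_content n \<delta> A =
     (INF U \<in> {U :: nat \<Rightarrow> 'a set. A \<subseteq> (\<Union>i. U i) \<and> (\<forall>i. bounded (U i) \<and> diameter (U i) \<le> \<delta>)}.
        \<Sum>i. hausdorff_weight n (U i))"

definition hausdorff_outer :: "nat \<Rightarrow> 'a::metric_space set \<Rightarrow> ennreal" where
  "hausdorff_outer n A = (SUP \<delta> \<in> {0<..}. hausdorff_content n \<delta> A)"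

definition hausdorff_measure :: "nat \<Rightarrow> 'a::metric_space measure" where
  "hausdorff_measure n = measure_of UNIV (sets borel) (hausdorff_outer n)"

definition surface_measure :: "'a::euclidean_space set \<Rightarrow> 'a measure" where
  "surface_measure \<Gamma> = restrict_space (hausdorff_measure (DIM('a) - 1)) \<Gamma>"

text \<open>
  \<^const>\<open>measure_of\<close> yields the null measure when the given set function is not countably
  additive. The following lemmas show that this does not happen here: Borel sets are
  Caratheodory-measurable for the outer measure.
\<close>

lemma hausdorff_weight_mono:
  assumes "U \<subseteq> V" "bounded V"
  shows "hausdorff_weight n U \<le> hausdorff_weight n V"
proof -
  have "diameter U \<le> diameter V" "0 \<le> diameter U"
    using assms diameter_subset diameter_ge_0 bounded_subset by blast+
  then have "unit_ball_vol (real n) * (diameter U / 2) ^ n \<le> unit_ball_vol (real n) * (diameter V / 2) ^ n"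
    by (intro mult_left_mono power_mono) auto
  then show ?thesis
    using assms by (auto simp: hausdorff_weight_def intro: ennreal_leI)
qed

lemma hausdorff_content_le:
  assumes "A \<subseteq> (\<Union>i. U i)" "\<And>i. bounded (U i)" "\<And>i. diameter (U i) \<le> \<delta>"
  shows "hausdorff_content n \<delta> A \<le> (\<Sum>i. hausdorff_weight n (U i))"
  unfolding hausdorff_content_def using assms by (intro INF_lower) auto

lemma hausdorff_content_cover:
  assumes "hausdorff_content n \<delta> A < e"
  shows "\<exists>U. A \<subseteq> (\<Union>i. U i) \<and> (\<forall>i. bounded (U i) \<and> diameter (U i) \<le> \<delta>) \<and>
             (\<Sum>i. hausdorff_weight n (U i)) \<le> e"
proof -
  obtain U where "U \<in> {U :: nat \<Rightarrow> 'a set. A \<subseteq> (\<Union>i. U i) \<and> (\<forall>i. bounded (U i) \<and> diameter (U i) \<le> \<delta>)}"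
      "(\<Sum>i. hausdorff_weight n (U i)) < e"
    using assms unfolding hausdorff_content_def INF_less_iff by blast
  then show ?thesis
    by (intro exI[of _ U]) auto
qed

lemma hausdorff_content_mono: "A \<subseteq> B \<Longrightarrow> hausdorff_content n \<delta> A \<le> hausdorff_content n \<delta> B"
  unfolding hausdorff_content_def by (rule INF_superset_mono) auto

lemma hausdorff_content_antimono: "\<delta> \<le> \<delta>' \<Longrightarrow> hausdorff_content n \<delta>' A \<le> hausdorff_content n \<delta> A"
  unfolding hausdorff_content_def by (rule INF_superset_mono) (auto intro: order_trans)

lemma hausdorff_content_UN:
  fixes A :: "nat \<Rightarrow> 'a::metric_space set"
  shows "hausdorff_content n \<delta> (\<Union>i. A i) \<le> (\<Sum>i. hausdorff_content n \<delta> (A i))"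
proof (rule ennreal_le_epsilon)
  fix e :: real assume e: "0 < e" and "(\<Sum>i. hausdorff_content n \<delta> (A i)) < Orderings.top"
  then have "hausdorff_content n \<delta> (A i) < hausdorff_content n \<delta> (A i) + e * (1/2) ^ Suc i" for i
    by (auto simp add: less_top dest!: ennreal_suminf_lessD)
  then have "\<exists>U. A i \<subseteq> (\<Union>j. U j) \<and> (\<forall>j. bounded (U j) \<and> diameter (U j) \<le> \<delta>) \<and>
      (\<Sum>j. hausdorff_weight n (U j)) \<le> hausdorff_content n \<delta> (A i) + e * (1/2) ^ Suc i" for i
    by (rule hausdorff_content_cover)
  then obtain U where U: "\<And>i. A i \<subseteq> (\<Union>j. U i j)" "\<And>i j. bounded (U i j)" "\<And>i j. diameter (U i j) \<le> \<delta>"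
      "\<And>i. (\<Sum>j. hausdorff_weight n (U i j)) \<le> hausdorff_content n \<delta> (A i) + e * (1/2) ^ Suc i"
    by metis
  define V where "V k = (case prod_decode k of (i, j) \<Rightarrow> U i j)" for k
  have "(\<Union>i. A i) \<subseteq> (\<Union>k. V k)"
    using U(1) by (auto simp: V_def subset_eq) (metis prod.case prod_encode_inverse)
  then have "hausdorff_content n \<delta> (\<Union>i. A i) \<le> (\<Sum>k. hausdorff_weight n (V k))"
    using U by (intro hausdorff_content_le) (auto simp: V_def split: prod.split)
  also have "\<dots> = (\<Sum>k. (\<lambda>(i, j). hausdorff_weight n (U i j)) (prod_decode k))"
    by (simp add: V_def split_def)
  also have "\<dots> = (\<Sum>i. \<Sum>j. hausdorff_weight n (U i j))"
    by (rule suminf_ennreal_2dimen) simp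
  also have "\<dots> \<le> (\<Sum>i. hausdorff_content n \<delta> (A i) + e * (1/2) ^ Suc i)"
    using U(4) by (intro suminf_le) auto
  also have "\<dots> = (\<Sum>i. hausdorff_content n \<delta> (A i)) + (\<Sum>i. ennreal e * ennreal ((1/2) ^ Suc i))"
    using e by (subst suminf_add[symmetric])
      (auto simp del: ennreal_suminf_cmult simp add: ennreal_mult[symmetric])
  also have "\<dots> = (\<Sum>i. hausdorff_content n \<delta> (A i)) + e"
    unfolding ennreal_suminf_cmult
    by (subst suminf_ennreal_eq[OF zero_le_power power_half_series]) auto
  finally show "hausdorff_content n \<delta> (\<Union>i. A i) \<le> (\<Sum>i. hausdorff_content n \<delta> (A i)) + e" .
qed

lemma hausdorff_outer_empty: "hausdorff_outer n ({} :: 'a::metric_space set) = 0"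
proof -
  have "hausdorff_content n \<delta> ({} :: 'a set) = 0" if "0 < \<delta>" for \<delta>
    using hausdorff_content_le[of "{} :: 'a set" "\<lambda>_. {}" \<delta> n] that by (simp add: hausdorff_weight_def)
  then show ?thesis
    unfolding hausdorff_outer_def by (intro antisym SUP_least) auto
qed

lemma hausdorff_outer_mono: "A \<subseteq> B \<Longrightarrow> hausdorff_outer n A \<le> hausdorff_outer n B"
  unfolding hausdorff_outer_def by (intro SUP_mono) (auto intro: hausdorff_content_mono)

lemma hausdorff_outer_UN:
  fixes A :: "nat \<Rightarrow> 'a::metric_space set"
  shows "hausdorff_outer n (\<Union>i. A i) \<le> (\<Sum>i. hausdorff_outer n (A i))"
  unfolding hausdorff_outer_def
  by (intro SUP_least order_trans[OF hausdorff_content_UN] suminf_le SUP_upper) auto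

lemma hausdorff_outer_space:
  "outer_measure_space UNIV (hausdorff_outer n :: 'a::metric_space set \<Rightarrow> ennreal)"
  by (auto simp: outer_measure_space_def positive_def increasing_def countably_subadditive_def
      hausdorff_outer_empty hausdorff_outer_mono hausdorff_outer_UN)

lemma hausdorff_outer_Un_separated:
  fixes A B :: "'a::metric_space set"
  assumes "0 < \<eta>" and sep: "\<And>a b. a \<in> A \<Longrightarrow> b \<in> B \<Longrightarrow> \<eta> \<le> dist a b"
  shows "hausdorff_outer n A + hausdorff_outer n B \<le> hausdorff_outer n (A \<union> B)"
proof -
  have content: "hausdorff_content n \<delta> A + hausdorff_content n \<delta> B \<le> hausdorff_content n \<delta> (A \<union> B)"
    if "0 < \<delta>" "\<delta> < \<eta>" for \<delta>
  proof (subst (3) hausdorff_content_def, intro INF_greatest, clarsimp)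
    fix U :: "nat \<Rightarrow> 'a set"
    assume "A \<subseteq> (\<Union>i. U i)" "B \<subseteq> (\<Union>i. U i)" and U: "\<forall>i. bounded (U i) \<and> diameter (U i) \<le> \<delta>"
    then have cover: "A \<subseteq> (\<Union>i. U i \<inter> A)" "B \<subseteq> (\<Union>i. U i \<inter> B)"
      by auto
    have small: "bounded (U i \<inter> S)" "diameter (U i \<inter> S) \<le> \<delta>" for i S
      using U diameter_subset[of "U i \<inter> S" "U i"] by (auto intro: bounded_subset order_trans)
    have "U i \<inter> A = {} \<or> U i \<inter> B = {}" for i
    proof (rule ccontr)
      assume "\<not> ?thesis"
      then obtain a b where "a \<in> U i" "a \<in> A" "b \<in> U i" "b \<in> B"
        by auto
      then have "dist a b \<le> \<delta>" "\<eta> \<le> dist a b"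
        using U diameter_bounded_bound[of "U i" a b] sep by (auto intro: order_trans)
      then show False
        using \<open>\<delta> < \<eta>\<close> by simp
    qed
    then have split: "hausdorff_weight n (U i \<inter> A) + hausdorff_weight n (U i \<inter> B) \<le> hausdorff_weight n (U i)" for i
      using hausdorff_weight_mono[of "U i \<inter> A" "U i" n] hausdorff_weight_mono[of "U i \<inter> B" "U i" n] U
      by (metis Int_lower1 add.left_neutral add.right_neutral hausdorff_weight_def)
    have "hausdorff_content n \<delta> A + hausdorff_content n \<delta> B
        \<le> (\<Sum>i. hausdorff_weight n (U i \<inter> A)) + (\<Sum>i. hausdorff_weight n (U i \<inter> B))"
      by (intro add_mono hausdorff_content_le cover small)
    also have "\<dots> = (\<Sum>i. hausdorff_weight n (U i \<inter> A) + hausdorff_weight n (U i \<inter> B))"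
      by (rule suminf_add) auto
    also have "\<dots> \<le> (\<Sum>i. hausdorff_weight n (U i))"
      by (intro suminf_le split) auto
    finally show "hausdorff_content n \<delta> A + hausdorff_content n \<delta> B \<le> (\<Sum>i. hausdorff_weight n (U i))" .
  qed
  have "hausdorff_outer n A + hausdorff_outer n B
      = (SUP \<delta>\<in>{0<..}. hausdorff_content n \<delta> A + hausdorff_content n \<delta> B)"
    unfolding hausdorff_outer_def
  proof (rule SUP_add_directed_ennreal[symmetric])
    fix \<delta> \<delta>' :: real assume "\<delta> \<in> {0<..}" "\<delta>' \<in> {0<..}"
    then show "\<exists>k\<in>{0<..}. hausdorff_content n \<delta> A + hausdorff_content n \<delta>' B
        \<le> hausdorff_content n k A + hausdorff_content n k B"
      by (intro bexI[of _ "min \<delta> \<delta>'"] add_mono hausdorff_content_antimono) auto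
  qed
  also have "\<dots> \<le> hausdorff_outer n (A \<union> B)"
  proof (rule SUP_least)
    fix \<delta> :: real assume "\<delta> \<in> {0<..}"
    then have d: "0 < min \<delta> (\<eta> / 2)" "min \<delta> (\<eta> / 2) < \<eta>"
      using \<open>0 < \<eta>\<close> by auto
    have "hausdorff_content n \<delta> A + hausdorff_content n \<delta> B
        \<le> hausdorff_content n (min \<delta> (\<eta> / 2)) A + hausdorff_content n (min \<delta> (\<eta> / 2)) B"
      by (intro add_mono hausdorff_content_antimono) auto
    also have "\<dots> \<le> hausdorff_content n (min \<delta> (\<eta> / 2)) (A \<union> B)"
      by (rule content[OF d])
    also have "\<dots> \<le> hausdorff_outer n (A \<union> B)"
      unfolding hausdorff_outer_def using d by (intro SUP_upper) auto
    finally show "hausdorff_content n \<delta> A + hausdorff_content n \<delta> B \<le> hausdorff_outer n (A \<union> B)" .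
  qed
  finally show ?thesis .
qed

lemma closed_in_lambda_system_hausdorff:
  fixes C :: "'a::metric_space set"
  assumes "closed C"
  shows "C \<in> lambda_system UNIV UNIV (hausdorff_outer n)"
proof (cases "C = {}")
  case True
  then show ?thesis
    by (simp add: lambda_system_def hausdorff_outer_empty)
next
  case False
  let ?H = "hausdorff_outer n :: 'a set \<Rightarrow> ennreal"
  note H0 = hausdorff_outer_empty[of n, where 'a='a]
  note mono = hausdorff_outer_mono[of _ _ n, where 'a='a]
  note sub = hausdorff_outer_UN[of n, where 'a='a]
  have sub2: "?H (A \<union> B) \<le> ?H A + ?H B" for A B
  proof -
    have "?H (\<Union>i. case_nat A (\<lambda>i. case_nat B (\<lambda>_. {}) i) i) \<le> (\<Sum>i. ?H (case_nat A (\<lambda>i. case_nat B (\<lambda>_. {}) i) i))"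
      by (rule sub)
    also have "(\<Union>i. case_nat A (\<lambda>i. case_nat B (\<lambda>_. {}) i) i) = A \<union> B"
      by (auto split: nat.splits intro: exI[of _ 0] exI[of _ "Suc 0"])
    also have "(\<Sum>i. ?H (case_nat A (\<lambda>i. case_nat B (\<lambda>_. {}) i) i)) = (\<Sum>i<2. ?H (case_nat A (\<lambda>i. case_nat B (\<lambda>_. {}) i) i))"
      by (rule suminf_finite) (auto simp: H0 split: nat.splits)
    finally show ?thesis
      by (simp add: numeral_2_eq_2)
  qed
  have main: "?H (C \<inter> T) + ?H ((UNIV - C) \<inter> T) \<le> ?H T" if fin: "?H T < Orderings.top" for T
  proof -
    define T' where "T' k = {x \<in> T. inverse (real (Suc k)) \<le> infdist x C}" for k
    define R where "R j = {x \<in> T. inverse (real (Suc (Suc j))) \<le> infdist x C \<and>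
                                  infdist x C < inverse (real (Suc j))}" for j
    have T': "?H (C \<inter> T) + ?H (T' k) \<le> ?H T" for k
    proof -
      have "?H (C \<inter> T) + ?H (T' k) \<le> ?H (C \<inter> T \<union> T' k)"
      proof (rule hausdorff_outer_Un_separated)
        show "0 < inverse (real (Suc k))" by simp
        fix a b assume "a \<in> C \<inter> T" "b \<in> T' k"
        then show "inverse (real (Suc k)) \<le> dist a b"
          using infdist_le[of a C b] by (auto simp: T'_def dist_commute)
      qed
      also have "\<dots> \<le> ?H T"
        by (rule mono) (auto simp: T'_def)
      finally show ?thesis .
    qed
    have Rsum: "(\<Sum>i<m. ?H (R (2 * i + p))) \<le> ?H (\<Union>i<m. R (2 * i + p))" for m p
    proof (induction m)
      case (Suc m)
      have "?H (\<Union>i<m. R (2 * i + p)) + ?H (R (2 * m + p))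
          \<le> ?H ((\<Union>i<m. R (2 * i + p)) \<union> R (2 * m + p))"
      proof (cases m)
        case 0
        then show ?thesis by (simp add: H0)
      next
        case (Suc l)
        define \<eta> where "\<eta> = inverse (real (2 * m + p)) - inverse (real (2 * m + p + 1))"
        show ?thesis
        proof (rule hausdorff_outer_Un_separated[of \<eta>])
          show "0 < \<eta>"
            unfolding \<eta>_def diff_gt_0_iff_gt
            using Suc by (intro less_imp_inverse_less) auto
          fix a b assume "a \<in> (\<Union>i<m. R (2 * i + p))" and b: "b \<in> R (2 * m + p)"
          then obtain i where i: "i < m" "a \<in> R (2 * i + p)" by auto
          have "inverse (real (2 * m + p)) \<le> inverse (real (Suc (Suc (2 * i + p))))"
            using i(1) by (intro le_imp_inverse_le) (auto simp flip: of_nat_Suc)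
          also have "\<dots> \<le> infdist a C"
            using i(2) by (simp add: R_def)
          finally have "inverse (real (2 * m + p)) \<le> infdist a C" .
          moreover have "infdist b C < inverse (real (2 * m + p + 1))"
            using b by (simp add: R_def add.commute)
          moreover have "infdist a C \<le> infdist b C + dist a b"
            by (rule infdist_triangle)
          ultimately show "\<eta> \<le> dist a b"
            by (simp add: \<eta>_def)
        qed
      qed
      also have "(\<Union>i<m. R (2 * i + p)) \<union> R (2 * m + p) = (\<Union>i<Suc m. R (2 * i + p))"
        by (auto simp: less_Suc_eq)
      finally show ?case
        using order_trans[OF add_right_mono[OF Suc.IH]] unfolding sum.lessThan_Suc by blast
    qed (simp add: H0)
    have Rfin: "(\<Sum>i. ?H (R (2 * i + p))) \<le> ?H T" for p
    proof (rule suminf_le_const)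
      fix m
      have "(\<Sum>i<m. ?H (R (2 * i + p))) \<le> ?H (\<Union>i<m. R (2 * i + p))" by (rule Rsum)
      also have "\<dots> \<le> ?H T" by (rule mono) (auto simp: R_def)
      finally show "(\<Sum>i<m. ?H (R (2 * i + p))) \<le> ?H T" .
    qed simp
    have "(\<Sum>j<m. ?H (R j)) \<le> ?H T + ?H T" for m
    proof -
      have "(\<Sum>j<m. ?H (R j)) \<le> (\<Sum>j<2*m. ?H (R j))"
        by (rule sum_mono2) auto
      also have "\<dots> = (\<Sum>i<m. ?H (R (2 * i + 0))) + (\<Sum>i<m. ?H (R (2 * i + 1)))"
        by (induction m) (simp_all add: algebra_simps)
      also have "\<dots> \<le> (\<Sum>i. ?H (R (2 * i + 0))) + (\<Sum>i. ?H (R (2 * i + 1)))"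
        by (intro add_mono sum_le_suminf) auto
      also have "\<dots> \<le> ?H T + ?H T"
        by (intro add_mono Rfin)
      finally show ?thesis .
    qed
    then have "(\<Sum>j. ?H (R j)) \<le> ?H T + ?H T"
      by (intro suminf_le_const) auto
    also have "\<dots> < Orderings.top"
      using fin by simp
    finally have Rtop: "(\<Sum>j. ?H (R j)) < Orderings.top" .
    have tail: "(\<lambda>k. \<Sum>j. ?H (R (j + k))) \<longlonglongrightarrow> 0"
    proof -
      define r where "r j = enn2real (?H (R j))" for j
      have Hr: "?H (R j) = ennreal (r j)" for j
        using ennreal_suminf_lessD[OF Rtop, of j] by (simp add: r_def)
      have r0: "0 \<le> r j" for j
        by (simp add: r_def)
      have sm: "summable r"
        using Rtop unfolding Hr by (intro summable_suminf_not_top r0) simp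
      have "(\<Sum>j. ?H (R (j + k))) = ennreal (\<Sum>j. r (j + k))" for k
        unfolding Hr by (intro suminf_ennreal2 r0 summable_ignore_initial_segment sm)
      moreover have "(\<lambda>k. \<Sum>j. r (j + k)) \<longlonglongrightarrow> 0"
        using suminf_exist_split2[OF sm] by simp
      ultimately show ?thesis
        using tendsto_ennrealI[of "\<lambda>k. \<Sum>j. r (j + k)" 0] by simp
    qed
    have bound: "?H (C \<inter> T) + ?H ((UNIV - C) \<inter> T) \<le> ?H T + (\<Sum>j. ?H (R (j + k)))" for k
    proof -
      have "(UNIV - C) \<inter> T \<subseteq> T' k \<union> (\<Union>j. R (j + k))"
      proof
        fix x assume x: "x \<in> (UNIV - C) \<inter> T"
        have "0 < infdist x C"
          using x assms False in_closed_iff_infdist_zero[of C x] infdist_nonneg[of x C] by auto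
        then obtain n where n: "inverse (real (Suc n)) < infdist x C"
          using reals_Archimedean by blast
        define l where "l = (LEAST l. inverse (real (Suc l)) \<le> infdist x C)"
        have l: "inverse (real (Suc l)) \<le> infdist x C"
          unfolding l_def by (rule LeastI[of _ n]) (use n in simp)
        show "x \<in> T' k \<union> (\<Union>j. R (j + k))"
        proof (cases "l \<le> k")
          case True
          then have "inverse (real (Suc k)) \<le> inverse (real (Suc l))"
            by (intro le_imp_inverse_le) auto
          then have "inverse (real (Suc k)) \<le> infdist x C"
            using l by linarith
          then show ?thesis using x by (simp add: T'_def)
        next
          case False
          then obtain l' where l': "l = Suc l'" "k \<le> l'"
            by (cases l) auto
          then have "l' < l"
            by simp
          then have "\<not> inverse (real (Suc l')) \<le> infdist x C"
            unfolding l_def by (rule not_less_Least)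
          then have "x \<in> R ((l' - k) + k)"
            using l l' x by (simp add: R_def)
          then show ?thesis by blast
        qed
      qed
      then have "?H ((UNIV - C) \<inter> T) \<le> ?H (T' k) + ?H (\<Union>j. R (j + k))"
        by (rule order_trans[OF mono sub2])
      also have "\<dots> \<le> ?H (T' k) + (\<Sum>j. ?H (R (j + k)))"
        by (intro add_mono sub) auto
      finally have "?H (C \<inter> T) + ?H ((UNIV - C) \<inter> T) \<le> (?H (C \<inter> T) + ?H (T' k)) + (\<Sum>j. ?H (R (j + k)))"
        by (simp add: add.assoc add_left_mono)
      also have "\<dots> \<le> ?H T + (\<Sum>j. ?H (R (j + k)))"
        by (intro add_right_mono T')
      finally show ?thesis .
    qed
    have "(\<lambda>k. ?H T + (\<Sum>j. ?H (R (j + k)))) \<longlonglongrightarrow> ?H T + 0"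
      by (intro tendsto_add tendsto_const tail)
    then show ?thesis
      using bound by (intro LIMSEQ_le_const) auto
  qed
  have "?H (C \<inter> T) + ?H ((UNIV - C) \<inter> T) = ?H T" for T
  proof (rule antisym)
    show "?H (C \<inter> T) + ?H ((UNIV - C) \<inter> T) \<le> ?H T"
      using main[of T] by (cases "?H T = Orderings.top") (auto simp: less_top)
    show "?H T \<le> ?H (C \<inter> T) + ?H ((UNIV - C) \<inter> T)"
      by (rule order_trans[OF mono sub2]) auto
  qed
  then show ?thesis
    by (simp add: lambda_system_def)
qed

lemma measure_space_hausdorff:
  "measure_space UNIV (sets borel) (hausdorff_outer n :: 'a::metric_space set \<Rightarrow> ennreal)"
proof -
  interpret sigma_algebra UNIV "UNIV :: 'a set set"
    using sigma_algebra_Pow[of "UNIV :: 'a set"] by simp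
  let ?L = "lambda_system UNIV UNIV (hausdorff_outer n :: 'a set \<Rightarrow> ennreal)"
  have L: "measure_space UNIV ?L (hausdorff_outer n)"
    by (rule caratheodory_lemma[OF hausdorff_outer_space])
  have "sigma_sets UNIV {C :: 'a set. closed C} \<subseteq> ?L"
    using L closed_in_lambda_system_hausdorff
    by (intro sigma_algebra.sigma_sets_subset) (auto simp: measure_space_def)
  then have "sets borel \<subseteq> ?L"
    by (simp add: borel_eq_closed)
  moreover have "sigma_algebra UNIV (sets (borel :: 'a measure))"
    using sets.sigma_algebra_axioms[of "borel :: 'a measure"] by simp
  ultimately show ?thesis
    using measure_down[OF L] by blast
qed

lemma sets_hausdorff_measure [simp]: "sets (hausdorff_measure n) = sets borel"
  and space_hausdorff_measure [simp]: "space (hausdorff_measure n) = UNIV"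
  using sets.sigma_sets_eq[of "borel :: 'a::metric_space measure"]
  by (simp_all add: hausdorff_measure_def)

lemma emeasure_hausdorff_measure:
  assumes "A \<in> sets borel"
  shows "emeasure (hausdorff_measure n) A = hausdorff_outer n A"
  unfolding hausdorff_measure_def
  using measure_space_hausdorff[of n, where 'a='a] assms
  by (intro emeasure_measure_of_sigma) (auto simp: measure_space_def)

section \<open>Domains with twice continuously differentiable boundary\<close>

definition C2_function :: "('a::euclidean_space \<Rightarrow> real) \<Rightarrow> bool" where
  "C2_function f \<longleftrightarrow>
     (\<exists>(f' :: 'a \<Rightarrow> 'a \<Rightarrow>\<^sub>L real) (f'' :: 'a \<Rightarrow> 'a \<Rightarrow>\<^sub>L 'a \<Rightarrow>\<^sub>L real).
        (\<forall>x. (f has_derivative blinfun_apply (f' x)) (at x)) \<and>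
        (\<forall>x. (f' has_derivative blinfun_apply (f'' x)) (at x)) \<and>
        continuous_on UNIV f'')"

text \<open>
  Near each boundary point the domain is the region above the graph of a \<open>C\<^sup>2\<close> function over the
  hyperplane orthogonal to some unit vector \<open>\<nu>\<close>. The function \<open>\<gamma>\<close> is only evaluated at the
  orthogonal projection \<open>y - (y \<bullet> \<nu>) \<nu>\<close> of \<open>y\<close> to that hyperplane.
\<close>

definition C2_boundary :: "'a::euclidean_space set \<Rightarrow> bool" where
  "C2_boundary \<Omega> \<longleftrightarrow>
     (\<forall>x \<in> frontier \<Omega>. \<exists>r > 0. \<exists>\<nu> \<gamma>. norm \<nu> = 1 \<and> C2_function \<gamma> \<and>
        \<Omega> \<inter> ball x r = {y \<in> ball x r. \<gamma> (y - inner y \<nu> *\<^sub>R \<nu>) < inner y \<nu>})"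

definition bounded_C2_domain :: "'a::euclidean_space set \<Rightarrow> bool" where
  "bounded_C2_domain \<Omega> \<longleftrightarrow>
     open \<Omega> \<and> connected \<Omega> \<and> \<Omega> \<noteq> {} \<and> bounded \<Omega> \<and> C2_boundary \<Omega>"

section \<open>Functions on the boundary\<close>

text \<open>
  A real function on \<open>\<Gamma>\<close> as an element of a function space is represented by an extensional
  function on the ambient space, so that equality of elements is equality on \<open>\<Gamma>\<close>.
  The norm of the space is the separate argument \<open>nrm\<close>.
\<close>

definition normed_function_space ::
    "'a::topological_space set \<Rightarrow> ('a \<Rightarrow> real) set \<Rightarrow> (('a \<Rightarrow> real) \<Rightarrow> real) \<Rightarrow> bool" where
  "normed_function_space \<Gamma> X nrm \<longleftrightarrow>
     X \<subseteq> {v \<in> extensional \<Gamma>. continuous_on \<Gamma> v} \<and>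
     (\<lambda>x\<in>\<Gamma>. 0) \<in> X \<and>
     (\<forall>u\<in>X. \<forall>v\<in>X. (\<lambda>x\<in>\<Gamma>. u x + v x) \<in> X) \<and>
     (\<forall>c. \<forall>v\<in>X. (\<lambda>x\<in>\<Gamma>. c * v x) \<in> X) \<and>
     (\<forall>v\<in>X. 0 \<le> nrm v \<and> (nrm v = 0 \<longleftrightarrow> v = (\<lambda>x\<in>\<Gamma>. 0))) \<and>
     (\<forall>c. \<forall>v\<in>X. nrm (\<lambda>x\<in>\<Gamma>. c * v x) = \<bar>c\<bar> * nrm v) \<and>
     (\<forall>u\<in>X. \<forall>v\<in>X. nrm (\<lambda>x\<in>\<Gamma>. u x + v x) \<le> nrm u + nrm v)"

definition L2_boundary_norm :: "'a::euclidean_space set \<Rightarrow> ('a \<Rightarrow> real) \<Rightarrow> real" where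
  "L2_boundary_norm \<Gamma> v = sqrt (\<integral>y. (v y)\<^sup>2 \<partial>surface_measure \<Gamma>)"

definition boundary_operator ::
    "'a::euclidean_space set \<Rightarrow> ('a \<Rightarrow> 'a \<Rightarrow> real) \<Rightarrow> ('a \<Rightarrow> real) \<Rightarrow> 'a \<Rightarrow> real" where
  "boundary_operator \<Gamma> k \<rho> x = 1/2 * \<rho> x + (\<integral>y. k x y * \<rho> y \<partial>surface_measure \<Gamma>)"

definition continuum_residual ::
    "'a::euclidean_space set \<Rightarrow> ('a \<Rightarrow> 'a \<Rightarrow> real) \<Rightarrow> ('a \<Rightarrow> real) \<Rightarrow> ('a \<Rightarrow> real) \<Rightarrow> 'a \<Rightarrow> real" where
  "continuum_residual \<Gamma> k g \<rho> = (\<lambda>x\<in>\<Gamma>. boundary_operator \<Gamma> k \<rho> x - g x)"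

section \<open>Discretization\<close>

text \<open>
  The nodes of a level are \<open>xs 0, \<dots>, xs (N - 1)\<close>, with weights \<open>w 0, \<dots>, w (N - 1)\<close>.
\<close>

definition nodal_restriction :: "nat \<Rightarrow> (nat \<Rightarrow> 'a) \<Rightarrow> ('a \<Rightarrow> real) \<Rightarrow> real vec" where
  "nodal_restriction N xs v = vec N (\<lambda>j. v (xs j))"

definition weighted_norm :: "(nat \<Rightarrow> real) \<Rightarrow> real vec \<Rightarrow> real" where
  "weighted_norm w u = sqrt (\<Sum>j<dim_vec u. w j * (vec_index u j)\<^sup>2)"

definition nystroem_matrix ::
    "nat \<Rightarrow> (nat \<Rightarrow> 'a) \<Rightarrow> (nat \<Rightarrow> real) \<Rightarrow> ('a \<Rightarrow> 'a \<Rightarrow> real) \<Rightarrow> real mat" where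
  "nystroem_matrix N xs w \<kappa> = mat N N (\<lambda>(i, j). w j * \<kappa> (xs i) (xs j))"

definition discrete_operator ::
    "nat \<Rightarrow> (nat \<Rightarrow> 'a) \<Rightarrow> (nat \<Rightarrow> real) \<Rightarrow> ('a \<Rightarrow> 'a \<Rightarrow> real) \<Rightarrow> real mat" where
  "discrete_operator N xs w \<kappa> = (1/2) \<cdot>\<^sub>m 1\<^sub>m N + nystroem_matrix N xs w \<kappa>"

text \<open>
  The kernel \<open>\<kappa>\<close> of a Nystroem matrix may be a regularization of the (possibly singular)
  kernel \<open>k\<close>: it may differ from \<open>k\<close> at pairs of points of distance at most \<open>\<delta>\<close>.
  Since \<open>k\<close> itself is such a regularization, the unregularized matrix is included.
\<close>

definition near_diagonal_regularization ::
    "'a::metric_space set \<Rightarrow> real \<Rightarrow> ('a \<Rightarrow> 'a \<Rightarrow> real) \<Rightarrow> ('a \<Rightarrow> 'a \<Rightarrow> real) \<Rightarrow> bool" where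
  "near_diagonal_regularization \<Gamma> \<delta> k \<kappa> \<longleftrightarrow>
     (\<forall>x\<in>\<Gamma>. \<forall>y\<in>\<Gamma>. \<delta> < dist x y \<longrightarrow> \<kappa> x y = k x y)"

definition discrete_residual ::
    "nat \<Rightarrow> (nat \<Rightarrow> 'a) \<Rightarrow> (nat \<Rightarrow> real) \<Rightarrow> ('a \<Rightarrow> 'a \<Rightarrow> real) \<Rightarrow> ('a \<Rightarrow> real) \<Rightarrow> ('a \<Rightarrow> real) \<Rightarrow>
     real vec" where
  "discrete_residual N xs w \<kappa> g \<rho> =
     discrete_operator N xs w \<kappa> *\<^sub>v nodal_restriction N xs \<rho> - nodal_restriction N xs g"

definition discrete_loss ::
    "nat \<Rightarrow> (nat \<Rightarrow> 'a) \<Rightarrow> (nat \<Rightarrow> real) \<Rightarrow> ('a \<Rightarrow> 'a \<Rightarrow> real) \<Rightarrow> ('a \<Rightarrow> real) \<Rightarrow> ('a \<Rightarrow> real) \<Rightarrow>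
     real" where
  "discrete_loss N xs w \<kappa> g \<rho> = 1/2 * (weighted_norm w (discrete_residual N xs w \<kappa> g \<rho>))\<^sup>2"

end

theory Submission
  imports Defs
begin

text \<open>
  The loss is transferred from one level to the next through the continuum: the residual bound on
  level \<open>l\<close> controls the continuum residual in \<open>L\<^sup>2\<close> by the first inequality of (ii), and hence
  its nodal values on level \<open>l + 1\<close> by the second one. Since \<open>h (l + 1) \<le> h l \<le> h 1\<close>, each error
  term is at most a constant multiple of \<open>h l powr (2 * m)\<close>.
\<close>

lemma weighted_norm_nonneg:
  assumes "\<And>j. j < dim_vec u \<Longrightarrow> 0 \<le> w j"
  shows "0 \<le> weighted_norm w u"
  unfolding weighted_norm_def using assms by (auto intro!: sum_nonneg)

lemma weighted_norm_power2:
  assumes "\<And>j. j < dim_vec u \<Longrightarrow> 0 \<le> w j"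
  shows "(weighted_norm w u)\<^sup>2 = (\<Sum>j<dim_vec u. w j * (vec_index u j)\<^sup>2)"
  unfolding weighted_norm_def using assms by (auto intro!: real_sqrt_pow2 sum_nonneg)

lemma weighted_norm_minus_commute:
  assumes "dim_vec u = dim_vec v"
  shows "weighted_norm w (u - v) = weighted_norm w (v - u)"
  using assms by (simp add: weighted_norm_def power2_commute)

text \<open>A squared substitute for the triangle inequality, which moves between the nodal values
  of the continuum residual and the discrete residual. It holds coordinatewise:
  \<open>2 * b\<^sup>2 + 2 * (a - b)\<^sup>2 - a\<^sup>2\<close> is the square of
  \<open>a - 2 * b\<close>, and nonnegative weights preserve the inequality under summation.\<close>

lemma weighted_norm_power2_le:
  assumes "dim_vec u = dim_vec v" and w: "\<And>j. j < dim_vec v \<Longrightarrow> 0 \<le> w j"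
  shows "(weighted_norm w u)\<^sup>2 \<le> 2 * (weighted_norm w v)\<^sup>2 + 2 * (weighted_norm w (u - v))\<^sup>2"
proof -
  have sq: "a\<^sup>2 \<le> 2 * b\<^sup>2 + 2 * (a - b)\<^sup>2" for a b :: real
    using zero_le_power2[of "a - 2 * b"] by (simp add: power2_eq_square algebra_simps)
  have "w j * (vec_index u j)\<^sup>2 \<le> 2 * (w j * (vec_index v j)\<^sup>2) + 2 * (w j * (vec_index (u - v) j)\<^sup>2)"
    if "j < dim_vec v" for j
    using mult_left_mono[OF sq w[OF that], of "vec_index u j" "vec_index v j"] that
    by (simp add: algebra_simps)
  then have "(\<Sum>j<dim_vec v. w j * (vec_index u j)\<^sup>2)
      \<le> (\<Sum>j<dim_vec v. 2 * (w j * (vec_index v j)\<^sup>2) + 2 * (w j * (vec_index (u - v) j)\<^sup>2))"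
    by (intro sum_mono) auto
  moreover have "(weighted_norm w (u - v))\<^sup>2 = (\<Sum>j<dim_vec v. w j * (vec_index (u - v) j)\<^sup>2)"
    using w by (subst weighted_norm_power2) simp_all
  ultimately show ?thesis
    using assms by (simp add: weighted_norm_power2 sum.distrib sum_distrib_left)
qed

lemma dim_nodal_restriction [simp]: "dim_vec (nodal_restriction N xs v) = N"
  by (simp add: nodal_restriction_def)

lemma dim_discrete_residual [simp]: "dim_vec (discrete_residual N xs w \<kappa> g \<rho>) = N"
  by (simp add: discrete_residual_def)

text \<open>Split off the surplus power \<open>x powr (a - b)\<close>; its exponent is nonnegative,
  so it grows with the base. With the coarsest mesh size as \<open>y\<close>, this lowers the
  exponents \<open>2 * s\<close> and \<open>2 * \<nu>\<close> to \<open>2 * m\<close> at the price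
  of a factor independent of the level.\<close>

lemma powr_le_powr_mult_powr:
  fixes x y a b :: real
  assumes "0 < x" "x \<le> y" "b \<le> a"
  shows "x powr a \<le> y powr (a - b) * x powr b"
proof -
  have "x powr a = x powr (a - b) * x powr b"
    by (simp flip: powr_add)
  also have "\<dots> \<le> y powr (a - b) * x powr b"
    using assms by (intro mult_right_mono powr_mono2) auto
  finally show ?thesis .
qed

theorem mainTheorem2:
  fixes C_X C_S C_Q C_1 s \<nu> h_1 :: real
  assumes "CARD('d::finite) \<ge> 2" and "s > 0" and "\<nu> > 0"
  defines "m \<equiv> min s \<nu>"
  shows "\<exists>C :: real.
    \<forall>(\<Omega> :: (real^'d) set) \<Gamma> (k :: real^'d \<Rightarrow> real^'d \<Rightarrow> real) (g :: real^'d \<Rightarrow> real)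
      (\<rho> :: real^'p \<Rightarrow> real^'d \<Rightarrow> real) (\<Theta> :: (real^'p) set)
      (X :: (real^'d \<Rightarrow> real) set) (nrm :: (real^'d \<Rightarrow> real) \<Rightarrow> real)
      (lF :: nat) (h :: nat \<Rightarrow> real) (N :: nat \<Rightarrow> nat) (xs :: nat \<Rightarrow> nat \<Rightarrow> real^'d)
      (w :: nat \<Rightarrow> nat \<Rightarrow> real) (\<kappa> :: nat \<Rightarrow> real^'d \<Rightarrow> real^'d \<Rightarrow> real) (\<delta> :: nat \<Rightarrow> real).
      bounded_C2_domain \<Omega> \<and> \<Gamma> = frontier \<Omega> \<and>
      (\<forall>\<theta>. continuous_on \<Gamma> (\<rho> \<theta>)) \<and>
      (\<forall>\<theta>\<in>\<Theta>. \<forall>x\<in>\<Gamma>. integrable (surface_measure \<Gamma>) (\<lambda>y. k x y * \<rho> \<theta> y)) \<and>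
      normed_function_space \<Gamma> X nrm \<and>
      (\<forall>\<theta>\<in>\<Theta>. continuum_residual \<Gamma> k g (\<rho> \<theta>) \<in> X) \<and>
      (\<forall>l\<in>{1..lF}.
         h l > 0 \<and>
         xs l ` {..<N l} \<subseteq> \<Gamma> \<and> (\<forall>j<N l. w l j > 0) \<and>
         near_diagonal_regularization \<Gamma> (\<delta> l) k (\<kappa> l)) \<and>
      h 1 = h_1 \<and> (\<forall>l\<in>{1..<lF}. h (l + 1) \<le> h l) \<and>
      \<comment> \<open>(i)\<close>
      (\<forall>\<theta>\<in>\<Theta>. nrm (continuum_residual \<Gamma> k g (\<rho> \<theta>)) \<le> C_X) \<and>
      \<comment> \<open>(ii)\<close>
      (\<forall>l\<in>{1..lF}. \<forall>v\<in>X.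
         (L2_boundary_norm \<Gamma> v)\<^sup>2
           \<le> C_S * ((weighted_norm (w l) (nodal_restriction (N l) (xs l) v))\<^sup>2
                    + h l powr (2 * s) * (nrm v)\<^sup>2) \<and>
         (weighted_norm (w l) (nodal_restriction (N l) (xs l) v))\<^sup>2
           \<le> C_Q * ((L2_boundary_norm \<Gamma> v)\<^sup>2 + h l powr (2 * s) * (nrm v)\<^sup>2)) \<and>
      \<comment> \<open>(iii)\<close>
      (\<forall>l\<in>{1..lF}. \<forall>\<theta>\<in>\<Theta>.
         weighted_norm (w l)
           (nodal_restriction (N l) (xs l) (continuum_residual \<Gamma> k g (\<rho> \<theta>))
             - discrete_residual (N l) (xs l) (w l) (\<kappa> l) g (\<rho> \<theta>))
           \<le> C_1 * h l powr \<nu>)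
      \<longrightarrow>
      (\<forall>l\<in>{1..<lF}. \<forall>\<epsilon>\<ge>0. \<forall>\<theta>\<in>\<Theta>.
         discrete_loss (N l) (xs l) (w l) (\<kappa> l) g (\<rho> \<theta>) \<le> \<epsilon> \<longrightarrow>
         discrete_loss (N (l + 1)) (xs (l + 1)) (w (l + 1)) (\<kappa> (l + 1)) g (\<rho> \<theta>)
           \<le> C * (\<epsilon> + h l powr (2 * m)))"
proof -
  \<comment> \<open>Each summand is the price of lowering one of the exponents \<open>2 * s\<close>,
    \<open>2 * \<nu>\<close> to \<open>2 * m\<close>; both summands are nonnegative, so the sum
    dominates each of them.\<close>
  define M where "M = h_1 powr (2 * s - 2 * m) + h_1 powr (2 * \<nu> - 2 * m)"
  \<comment> \<open>This is the final bound of the chain below with both \<epsilon> and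
    \<open>P\<close> set to 1. The absolute values are there because \<open>C_S\<close> and
    \<open>C_Q\<close> carry no sign assumption. Only the given constants and \<open>h_1\<close>
    enter, so \<open>C\<close> can be fixed before the domain, the levels and the
    parameters.\<close>
  define C where "C = \<bar>C_Q\<bar> * (\<bar>C_S\<bar> * (4 + 2 * (C_1\<^sup>2 * M) + M * C_X\<^sup>2) + M * C_X\<^sup>2) + C_1\<^sup>2 * M"
  have M: "0 \<le> M"
    by (simp add: M_def)
  show ?thesis
  proof (rule exI[of _ C], intro allI impI ballI, elim conjE)
    fix \<Omega> \<Gamma> :: "(real^'d) set" and k :: "real^'d \<Rightarrow> real^'d \<Rightarrow> real" and g :: "real^'d \<Rightarrow> real"
      and \<rho> :: "real^'p \<Rightarrow> real^'d \<Rightarrow> real" and \<Theta> :: "(real^'p) set"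
      and X :: "(real^'d \<Rightarrow> real) set" and nrm :: "(real^'d \<Rightarrow> real) \<Rightarrow> real"
      and lF l :: nat and h :: "nat \<Rightarrow> real" and N :: "nat \<Rightarrow> nat"
      and xs :: "nat \<Rightarrow> nat \<Rightarrow> real^'d" and w :: "nat \<Rightarrow> nat \<Rightarrow> real"
      and \<kappa> :: "nat \<Rightarrow> real^'d \<Rightarrow> real^'d \<Rightarrow> real" and \<delta> :: "nat \<Rightarrow> real"
      and \<epsilon> :: real and \<theta> :: "real^'p"
    define r where "r = continuum_residual \<Gamma> k g (\<rho> \<theta>)"
    define p where "p i = nodal_restriction (N i) (xs i) r" for i
    define d where "d i = discrete_residual (N i) (xs i) (w i) (\<kappa> i) g (\<rho> \<theta>)" for i
    define P where "P = h l powr (2 * m)"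
    assume X: "normed_function_space \<Gamma> X nrm"
      and rX: "\<forall>\<theta>\<in>\<Theta>. continuum_residual \<Gamma> k g (\<rho> \<theta>) \<in> X"
      and lev: "\<forall>l\<in>{1..lF}. h l > 0 \<and> xs l ` {..<N l} \<subseteq> \<Gamma> \<and> (\<forall>j<N l. w l j > 0) \<and>
         near_diagonal_regularization \<Gamma> (\<delta> l) k (\<kappa> l)"
      and h1: "h 1 = h_1" and hdec: "\<forall>l\<in>{1..<lF}. h (l + 1) \<le> h l"
      and i: "\<forall>\<theta>\<in>\<Theta>. nrm (continuum_residual \<Gamma> k g (\<rho> \<theta>)) \<le> C_X"
      and ii: "\<forall>l\<in>{1..lF}. \<forall>v\<in>X.
         (L2_boundary_norm \<Gamma> v)\<^sup>2
           \<le> C_S * ((weighted_norm (w l) (nodal_restriction (N l) (xs l) v))\<^sup>2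
                    + h l powr (2 * s) * (nrm v)\<^sup>2) \<and>
         (weighted_norm (w l) (nodal_restriction (N l) (xs l) v))\<^sup>2
           \<le> C_Q * ((L2_boundary_norm \<Gamma> v)\<^sup>2 + h l powr (2 * s) * (nrm v)\<^sup>2)"
      and iii: "\<forall>l\<in>{1..lF}. \<forall>\<theta>\<in>\<Theta>.
         weighted_norm (w l)
           (nodal_restriction (N l) (xs l) (continuum_residual \<Gamma> k g (\<rho> \<theta>))
             - discrete_residual (N l) (xs l) (w l) (\<kappa> l) g (\<rho> \<theta>))
           \<le> C_1 * h l powr \<nu>"
      and l: "l \<in> {1..<lF}" and \<epsilon>: "0 \<le> \<epsilon>" and \<theta>: "\<theta> \<in> \<Theta>"
      and loss: "discrete_loss (N l) (xs l) (w l) (\<kappa> l) g (\<rho> \<theta>) \<le> \<epsilon>"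
    have lin: "l \<in> {1..lF}" "l + 1 \<in> {1..lF}"
      using l by auto
    \<comment> \<open>The guard \<open>i < lF\<close> sits inside the induction claim because the
      mesh sizes are known to decrease only up to level \<open>lF\<close>.\<close>
    have "i < lF \<longrightarrow> h i \<le> h_1" if "1 \<le> i" for i
      using that
    proof (induction i rule: dec_induct)
      case (step i)
      then show ?case
        using hdec by (auto intro: order_trans)
    qed (use h1 in simp)
    then have hl: "0 < h l" "h l \<le> h_1"
      using lev lin l by auto
    have hl': "0 < h (l + 1)" "h (l + 1) \<le> h l"
      using lev lin hdec l by auto
    have P: "0 \<le> P"
      by (simp add: P_def)
    have "h_1 powr (2 * s - 2 * m) \<le> M" "h_1 powr (2 * \<nu> - 2 * m) \<le> M"
      by (simp_all add: M_def)
    moreover have "h l powr (2 * s) \<le> h_1 powr (2 * s - 2 * m) * P"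
      "h l powr (2 * \<nu>) \<le> h_1 powr (2 * \<nu> - 2 * m) * P"
      unfolding P_def using hl by (auto intro!: powr_le_powr_mult_powr simp: m_def)
    ultimately have hP: "h l powr (2 * s) \<le> M * P" "h l powr (2 * \<nu>) \<le> M * P"
      using P by (meson mult_right_mono order_trans)+
    \<comment> \<open>The errors on the finer level are also measured by \<open>P\<close>, the power
      of the coarser mesh size, because the final estimate is in terms of
      \<open>h l\<close>.\<close>
    have "h (l + 1) powr (2 * s) \<le> h l powr (2 * s)" "h (l + 1) powr (2 * \<nu>) \<le> h l powr (2 * \<nu>)"
      using hl' assms by (auto intro!: powr_mono2)
    then have hP': "h (l + 1) powr (2 * s) \<le> M * P" "h (l + 1) powr (2 * \<nu>) \<le> M * P"
      using hP by linarith+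
    have r: "r \<in> X"
      using rX \<theta> by (simp add: r_def)
    \<comment> \<open>Nonnegativity of the norm on \<open>X\<close> is what allows (i) to be
      squared.\<close>
    then have "0 \<le> nrm r" "nrm r \<le> C_X"
      using X i \<theta> by (auto simp: normed_function_space_def r_def)
    then have nrm: "(nrm r)\<^sup>2 \<le> C_X\<^sup>2"
      by (rule power_mono[rotated])
    have wpos: "0 \<le> w i j" if "i \<in> {1..lF}" "j < N i" for i j
      using lev that by (simp add: less_imp_le)
    \<comment> \<open>The square of (iii), stated for a general level \<open>i\<close> but with
      \<open>P\<close> fixed at level \<open>l\<close>, so that it serves both \<open>l\<close> and
      \<open>l + 1\<close>. Squaring is legitimate because positive weights make the weighted norm
      nonnegative.\<close>
    have dist: "(weighted_norm (w i) (p i - d i))\<^sup>2 \<le> C_1\<^sup>2 * (M * P)"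
      if "i \<in> {1..lF}" and "h i powr (2 * \<nu>) \<le> M * P" for i
    proof -
      have "(weighted_norm (w i) (p i - d i))\<^sup>2 \<le> (C_1 * h i powr \<nu>)\<^sup>2"
      proof (rule power_mono)
        show "weighted_norm (w i) (p i - d i) \<le> C_1 * h i powr \<nu>"
          using iii that \<theta> by (simp add: p_def d_def r_def)
        show "0 \<le> weighted_norm (w i) (p i - d i)"
          using wpos[OF that(1)] by (intro weighted_norm_nonneg) (simp add: d_def)
      qed
      also have "\<dots> = C_1\<^sup>2 * h i powr (2 * \<nu>)"
        by (simp add: power_mult_distrib power2_eq_square flip: powr_add)
      also have "\<dots> \<le> C_1\<^sup>2 * (M * P)"
        using that by (intro mult_left_mono) auto
      finally show ?thesis .
    qed
    have smooth: "h i powr (2 * s) * (nrm r)\<^sup>2 \<le> M * P * C_X\<^sup>2" if "h i powr (2 * s) \<le> M * P" for i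
      using that nrm M P by (intro mult_mono) auto
    have "(weighted_norm (w l) (p l))\<^sup>2
        \<le> 2 * (weighted_norm (w l) (d l))\<^sup>2 + 2 * (weighted_norm (w l) (p l - d l))\<^sup>2"
      using wpos lin by (intro weighted_norm_power2_le) (auto simp: p_def d_def)
    \<comment> \<open>The 4 arises because the squared norm of \<open>d l\<close> is twice the loss
      and the splitting doubles it again.\<close>
    also have "\<dots> \<le> 4 * \<epsilon> + 2 * (C_1\<^sup>2 * (M * P))"
      using loss dist[OF lin(1) hP(2)] by (simp add: discrete_loss_def d_def)
    finally have nodal: "(weighted_norm (w l) (p l))\<^sup>2 \<le> 4 * \<epsilon> + 2 * (C_1\<^sup>2 * (M * P))" .
    have "(L2_boundary_norm \<Gamma> r)\<^sup>2
        \<le> C_S * ((weighted_norm (w l) (p l))\<^sup>2 + h l powr (2 * s) * (nrm r)\<^sup>2)"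
      using ii lin r by (simp add: p_def)
    \<comment> \<open>The bracket is nonnegative, so the constant may be replaced by its absolute
      value; only then can the bracket be enlarged.\<close>
    also have "\<dots> \<le> \<bar>C_S\<bar> * ((weighted_norm (w l) (p l))\<^sup>2 + h l powr (2 * s) * (nrm r)\<^sup>2)"
      by (intro mult_right_mono) auto
    also have "\<dots> \<le> \<bar>C_S\<bar> * (4 * \<epsilon> + 2 * (C_1\<^sup>2 * (M * P)) + M * P * C_X\<^sup>2)"
      using nodal smooth[OF hP(1)] by (intro mult_left_mono add_mono) auto
    finally have L2: "(L2_boundary_norm \<Gamma> r)\<^sup>2
        \<le> \<bar>C_S\<bar> * (4 * \<epsilon> + 2 * (C_1\<^sup>2 * (M * P)) + M * P * C_X\<^sup>2)" .
    \<comment> \<open>The change of level: the second part of (ii) is applied on level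
      \<open>l + 1\<close> to the same function \<open>r\<close>. The two node sets are compared
      only through the \<open>L2_boundary_norm\<close> of \<open>r\<close>.\<close>
    have "(weighted_norm (w (l + 1)) (p (l + 1)))\<^sup>2
        \<le> C_Q * ((L2_boundary_norm \<Gamma> r)\<^sup>2 + h (l + 1) powr (2 * s) * (nrm r)\<^sup>2)"
      using bspec[OF bspec[OF ii lin(2)] r] by (simp add: p_def)
    also have "\<dots> \<le> \<bar>C_Q\<bar> * ((L2_boundary_norm \<Gamma> r)\<^sup>2 + h (l + 1) powr (2 * s) * (nrm r)\<^sup>2)"
      by (intro mult_right_mono) auto
    also have "\<dots> \<le> \<bar>C_Q\<bar> *
        (\<bar>C_S\<bar> * (4 * \<epsilon> + 2 * (C_1\<^sup>2 * (M * P)) + M * P * C_X\<^sup>2) + M * P * C_X\<^sup>2)"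
      using L2 smooth[OF hP'(1)] by (intro mult_left_mono add_mono) auto
    finally have nodal': "(weighted_norm (w (l + 1)) (p (l + 1)))\<^sup>2 \<le> \<bar>C_Q\<bar> *
        (\<bar>C_S\<bar> * (4 * \<epsilon> + 2 * (C_1\<^sup>2 * (M * P)) + M * P * C_X\<^sup>2) + M * P * C_X\<^sup>2)" .
    \<comment> \<open>Now the splitting is used in the opposite direction, from the nodal values
      back to the discrete residual; the difference is then reversed to match
      \<open>dist\<close>.\<close>
    have "(weighted_norm (w (l + 1)) (d (l + 1)))\<^sup>2
        \<le> 2 * (weighted_norm (w (l + 1)) (p (l + 1)))\<^sup>2
          + 2 * (weighted_norm (w (l + 1)) (d (l + 1) - p (l + 1)))\<^sup>2"
      using wpos[OF lin(2)] by (intro weighted_norm_power2_le) (auto simp: p_def d_def)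
    also have "weighted_norm (w (l + 1)) (d (l + 1) - p (l + 1))
        = weighted_norm (w (l + 1)) (p (l + 1) - d (l + 1))"
      by (rule weighted_norm_minus_commute) (simp add: p_def d_def)
    \<comment> \<open>The factor 1/2 in the loss cancels the factor 2 of the splitting.\<close>
    finally have "discrete_loss (N (l + 1)) (xs (l + 1)) (w (l + 1)) (\<kappa> (l + 1)) g (\<rho> \<theta>)
        \<le> (weighted_norm (w (l + 1)) (p (l + 1)))\<^sup>2
          + (weighted_norm (w (l + 1)) (p (l + 1) - d (l + 1)))\<^sup>2"
      by (simp add: discrete_loss_def d_def)
    also have "\<dots> \<le> \<bar>C_Q\<bar> *
        (\<bar>C_S\<bar> * (4 * \<epsilon> + 2 * (C_1\<^sup>2 * (M * P)) + M * P * C_X\<^sup>2) + M * P * C_X\<^sup>2) + C_1\<^sup>2 * (M * P)"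
      using nodal' dist[OF lin(2) hP'(2)] by (rule add_mono)
    also have "\<dots> \<le> C * (\<epsilon> + P)"
    proof -
      \<comment> \<open>Expanding \<open>C * (\<epsilon> + P)\<close> reproduces the bound plus
        cross terms: the \<epsilon>-coefficient multiplied by \<open>P\<close> and the
        \<open>P\<close>-coefficients multiplied by \<epsilon>. All of these are
        nonnegative.\<close>
      have "C * (\<epsilon> + P) - (\<bar>C_Q\<bar> *
          (\<bar>C_S\<bar> * (4 * \<epsilon> + 2 * (C_1\<^sup>2 * (M * P)) + M * P * C_X\<^sup>2) + M * P * C_X\<^sup>2) + C_1\<^sup>2 * (M * P))
        = \<bar>C_Q\<bar> * (\<bar>C_S\<bar> * (4 * P + (2 * (C_1\<^sup>2 * M) + M * C_X\<^sup>2) * \<epsilon>) + M * C_X\<^sup>2 * \<epsilon>)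
          + C_1\<^sup>2 * M * \<epsilon>"
        by (simp add: C_def algebra_simps)
      also have "0 \<le> \<dots>"
        using M P \<epsilon> by (intro add_nonneg_nonneg mult_nonneg_nonneg) auto
      finally show ?thesis
        by simp
    qed
    finally show "discrete_loss (N (l + 1)) (xs (l + 1)) (w (l + 1)) (\<kappa> (l + 1)) g (\<rho> \<theta>)
        \<le> C * (\<epsilon> + h l powr (2 * m))"
      by (simp add: P_def)
  qed
qed

end
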